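(* (1) Let $1\le p<\infty$, let $\{W_n\}_{n\in\mathbb N}$ be a sequence of metric spaces with $\operatorname{diam}(W_n)=1$ for all $n\in\mathbb N$, and let $a=\{a_n\},b=\{b_n\}\in l^p_+$. Put $X=(l^p)\prod_{n=1}^\infty a_nW_n$ and $Y=(l^p)\prod_{n=1}^\infty b_nW_n$. Then $$2d_{GH}(X,Y)\le\sup_{S\subset\mathbb N}\Biggl|\Bigl(\sum_{n\in S}|a_n|^p\Bigr)^{1/p}-\Bigl(\sum_{n\in S}|b_n|^p\Bigr)^{1/p}\Biggr|.$$ (2) Let $\{W_\alpha\}_{\alpha\in A}$ be any family of metric spaces with $\operatorname{diam}(W_\alpha)=1$ for all $\alpha\in A$. Let $a=\{a_\alpha\}_{\alpha\in A}$ and $b=\{b_\alpha\}_{\alpha\in A}$ be families of numbers $a_\alpha\ge0$, $b_\alpha\ge0$ with $\sup_{\alpha\in A}a_\alpha<\infty$ and $\sup_{\alpha\in A}b_\alpha<\infty$. Put $X=(l^\infty)\prod_{\beta\in A}a_\beta W_\beta$ and $Y=(l^\infty)\prod_{\beta\in A}b_\beta W_\beta$. Then $$2d_{GH}(X,Y)\le\sup_{S\subset A}\Bigl|\sup_{\beta\in S}a_\beta-\sup_{\beta\in S}b_\beta\Bigr|.$$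
   Context: $l^p_+$ is the set of sequences $\{x_n\}_{n\in\mathbb N}\in l^p$ with $x_n\ge0$ for all $n$. $\operatorname{diam}(X)=\sup_{x,y\in X}d_X(x,y)$. The supremum (and the sum) over $S=\emptyset$ is taken to be $0$. A correspondence between $X$ and $Y$ is a subset $R\subset X\times Y$ whose projections to $X$ and to $Y$ are surjective; its distortion is $\operatorname{dis}R=\sup\{|d_X(x,x')-d_Y(y,y')| : (x,y),(x',y')\in R\}$. The Gromov--Hausdorff distance is $d_{GH}(X,Y)=\frac12\inf\{\operatorname{dis}R: R\text{ a correspondence between }X\text{ and }Y\}$. For a metric space $W=(W,d)$ and $\lambda>0$, $\lambda W$ is the space $(W,\lambda d)$. For $\lambda=0$, $0\cdot W$ denotes the set $W$ with the zero pseudometric (equivalently, for the purpose of $d_{GH}$, a one-point space). The $l^p$-product $(l^p)\prod_nX_n$ of spaces $(X_n,d_n)$ with $\sum_n(\operatorname{diam}X_n)^p<\infty$ is the Cartesian product with distance $d(\{x_n\},\{y_n\})=(\sum_nd_n(x_n,y_n)^p)^{1/p}$; the $l^\infty$-product $(l^\infty)\prod_{\alpha\in A}X_\alpha$ of spaces with $\sup_\alpha\operatorname{diam}(X_\alpha)<\infty$ is the Cartesian product with distance $\sup_{\alpha\in A}d_\alpha(x_\alpha,y_\alpha)$. *)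

theory Defs
  imports "HOL-Analysis.Analysis"
begin

text \<open>
  A carrier together with a distance function. No axioms are imposed: rescaling a metric space
  by zero only leaves a pseudometric, so the library type of metrics is too narrow for the
  rescaled spaces and their products.
\<close>

type_synonym 'a dist_space = "'a set \<times> ('a \<Rightarrow> 'a \<Rightarrow> real)"

abbreviation carr :: "'a dist_space \<Rightarrow> 'a set" where
  "carr \<equiv> fst"

abbreviation dst :: "'a dist_space \<Rightarrow> 'a \<Rightarrow> 'a \<Rightarrow> real" where
  "dst \<equiv> snd"

definition metric_diam :: "'a metric \<Rightarrow> ennreal" where
  "metric_diam W = (SUP x\<in>mspace W. SUP y\<in>mspace W. ennreal (mdist W x y))"

definition rescale :: "real \<Rightarrow> 'a metric \<Rightarrow> 'a dist_space" where
  "rescale c W = (mspace W, \<lambda>x y. c * mdist W x y)"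

definition correspondence :: "'a dist_space \<Rightarrow> 'b dist_space \<Rightarrow> ('a \<times> 'b) set \<Rightarrow> bool" where
  "correspondence X Y R \<longleftrightarrow>
     R \<subseteq> carr X \<times> carr Y \<and> fst ` R = carr X \<and> snd ` R = carr Y"

definition distortion :: "'a dist_space \<Rightarrow> 'b dist_space \<Rightarrow> ('a \<times> 'b) set \<Rightarrow> ennreal" where
  "distortion X Y R =
     (SUP (x, y)\<in>R. SUP (x', y')\<in>R. ennreal \<bar>dst X x x' - dst Y y y'\<bar>)"

definition gh_dist :: "'a dist_space \<Rightarrow> 'b dist_space \<Rightarrow> ennreal" where
  "gh_dist X Y = (1 / 2) * (INF R\<in>{R. correspondence X Y R}. distortion X Y R)"

definition lp_plus :: "real \<Rightarrow> (nat \<Rightarrow> real) set" where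
  "lp_plus p = {x. (\<lambda>n. \<bar>x n\<bar> powr p) summable_on UNIV \<and> (\<forall>n. x n \<ge> 0)}"

text \<open>
  The sum below is meaningful when the diameters of the factors are p-summable; otherwise
  \<^const>\<open>infsum\<close> may default to zero.
\<close>

definition lp_prod :: "real \<Rightarrow> (nat \<Rightarrow> 'a dist_space) \<Rightarrow> (nat \<Rightarrow> 'a) dist_space" where
  "lp_prod p X =
     (\<Pi>\<^sub>E n\<in>UNIV. carr (X n),
      \<lambda>x y. (\<Sum>\<^sub>\<infinity>n. dst (X n) (x n) (y n) powr p) powr (1 / p))"

text \<open>
  Supremum of a family of nonnegative reals, with value zero on the empty index set (where the
  real-valued \<^const>\<open>Sup\<close> is unspecified). It is meaningful for families bounded above.
\<close>

definition sup0 :: "'i set \<Rightarrow> ('i \<Rightarrow> real) \<Rightarrow> real" where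
  "sup0 S f = (if S = {} then 0 else (SUP i\<in>S. f i))"

definition linf_prod :: "'i set \<Rightarrow> ('i \<Rightarrow> 'a dist_space) \<Rightarrow> ('i \<Rightarrow> 'a) dist_space" where
  "linf_prod A X =
     (\<Pi>\<^sub>E i\<in>A. carr (X i),
      \<lambda>x y. sup0 A (\<lambda>i. dst (X i) (x i) (y i)))"

end

theory Submission
  imports Defs
begin

text \<open>
  The two products have the same underlying set, so the diagonal is a correspondence between
  them, and the task is to bound its distortion by the supremum on the right-hand side, which
  only sees coordinate distances equal to 0 or 1.

  For the \<open>l\<^sup>p\<close>-products, put \<open>t\<^sub>n = d(x\<^sub>n, x'\<^sub>n)\<^sup>p \<in> [0, 1]\<close>. The \<open>p\<close>-th powers of the two
  distances are the linear functionals \<open>u = \<Sum> a\<^sub>n\<^sup>p t\<^sub>n\<close> and \<open>v = \<Sum> b\<^sub>n\<^sup>p t\<^sub>n\<close> of \<open>t\<close>, and the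
  bound is known at the vertices of the cube, i.e. for indicator functions \<open>t\<close> of sets \<open>S\<close>.
  It passes to the whole cube because, for each \<open>c \<ge> 0\<close>, the region
  \<open>u\<^bsup>1/p\<^esup> \<le> v\<^bsup>1/p\<^esup> + c\<close> of the quadrant is convex: it is the hypograph of the concave function
  \<open>v \<mapsto> (c + v\<^bsup>1/p\<^esup>)\<^sup>p\<close>. Convex hulls of infinitely many vertices are avoided by using a
  supporting line \<open>u = K + M v\<close> of this hypograph (\<open>root_hypograph_supporting_line\<close>). The linear functional \<open>u - M v\<close>
  on the cube is maximised at the vertex where exactly the coordinates with positive
  coefficient are 1 (\<open>infsum_weighted_le_positive_part\<close>), and at this vertex it is at most \<open>K\<close> by assumption
  (\<open>powr_infsum_le_on_cube\<close>).

  For the \<open>l\<^sup>\<infinity>\<close>-products, singletons \<open>S\<close> already suffice: they give \<open>a\<^sub>i \<le> b\<^sub>i + c\<close>, and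
  multiplying by a coordinate distance in \<open>[0, 1]\<close> preserves this.
\<close>

section \<open>The diagonal correspondence\<close>

lemma mdist_le_1_if_diam_1:
  assumes "metric_diam W = 1" "x \<in> mspace W" "y \<in> mspace W"
  shows "mdist W x y \<le> 1"
proof -
  have "ennreal (mdist W x y) \<le> metric_diam W"
    unfolding metric_diam_def using assms(2,3) by (meson SUP_upper2 order_refl)
  then show ?thesis
    using assms(1) by simp
qed

lemma gh_dist_same_carrier_le:
  assumes carrier: "carr X = carr Y"
    and dist: "\<And>x x'. x \<in> carr X \<Longrightarrow> x' \<in> carr X \<Longrightarrow> \<bar>dst X x x' - dst Y x x'\<bar> \<le> c"
  shows "2 * gh_dist X Y \<le> ennreal c"
proof -
  let ?R = "(\<lambda>x. (x, x)) ` carr X"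
  have "correspondence X Y ?R"
    unfolding correspondence_def using carrier by force
  then have "(INF R\<in>{R. correspondence X Y R}. distortion X Y R) \<le> distortion X Y ?R"
    by (intro INF_lower) simp
  also have "\<dots> \<le> ennreal c"
    unfolding distortion_def using dist by (auto intro!: SUP_least ennreal_leI)
  finally have "(INF R\<in>{R. correspondence X Y R}. distortion X Y R) \<le> ennreal c" .
  moreover have "(2::ennreal) * (1 / 2) = 1"
    by (simp add: ennreal_times_divide)
  ultimately show ?thesis
    unfolding gh_dist_def by (simp add: mult.assoc[symmetric])
qed

text \<open>
  Turns an extended supremum into a real bound on each term. The case of an infinite supremum
  is absorbed here, so that it never has to be shown finite.
\<close>

lemma le_SUP_ennrealI:
  assumes "I \<noteq> {}"
    and "\<And>c. 0 \<le> c \<Longrightarrow> (\<And>i. i \<in> I \<Longrightarrow> \<bar>f i\<bar> \<le> c) \<Longrightarrow> x \<le> ennreal c"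
  shows "x \<le> (SUP i\<in>I. ennreal \<bar>f i\<bar>)"
proof (cases "SUP i\<in>I. ennreal \<bar>f i\<bar>")
  case (real c)
  have "\<bar>f i\<bar> \<le> c" if "i \<in> I" for i
    using SUP_upper[OF that, of "\<lambda>i. ennreal \<bar>f i\<bar>"] real by simp
  then show ?thesis
    using assms(2) real by simp
next
  case top
  then show ?thesis
    by (simp only: top_greatest)
qed

section \<open>From the vertices of a cube to the whole cube\<close>

text \<open>
  The line \<open>u = K + M v\<close> supports the graph of \<open>v \<mapsto> (c + v\<^bsup>1/p\<^esup>)\<^sup>p\<close> at \<open>v = s\<^sup>p\<close>; the lemma is
  written in the variable \<open>w = v\<^bsup>1/p\<^esup>\<close>. It is Jensen's inequality for the \<open>p\<close>-th power, with
  \<open>c + w\<close> written as the mean of \<open>c + s\<close> and \<open>w (c + s) / s\<close> with weights \<open>c / (c + s)\<close> and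
  \<open>s / (c + s)\<close>. For \<open>w = s\<close> the two points coincide, which gives equality.
\<close>

lemma root_hypograph_supporting_line:
  fixes p c s :: real
  assumes p: "1 \<le> p" and c: "0 \<le> c" and s: "0 < s"
  obtains K M where "K + M * s powr p = (c + s) powr p"
    "\<forall>w\<ge>0. (c + w) powr p \<le> K + M * w powr p"
proof
  define l where "l = s / (c + s)"
  define K where "K = (1 - l) * (c + s) powr p"
  define M where "M = l * ((c + s) / s) powr p"
  have l: "0 \<le> l" "l \<le> 1" and cl: "(1 - l) * (c + s) = c"
    using c s by (auto simp: l_def field_simps)
  show "K + M * s powr p = (c + s) powr p"
    using c s by (simp add: K_def M_def powr_divide algebra_simps)
  have "(c + w) powr p \<le> K + M * w powr p" if "0 \<le> w" for w
  proof (cases "w = 0")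
    \<comment> \<open>Here the second point of the mean is 0, outside the open half-line on which the
      convexity of the power is available.\<close>
    case True
    have "c powr p = (1 - l) powr p * (c + s) powr p"
      using l c s by (subst cl[symmetric]) (simp add: powr_mult)
    also have "(1 - l) powr p \<le> (1 - l) powr 1"
      using l p by (intro powr_mono') auto
    finally show ?thesis
      using l True p by (simp add: K_def mult_right_mono)
  next
    case False
    with that have w: "0 < w" by simp
    let ?y = "w * ((c + s) / s)"
    have "c + w = (1 - l) * (c + s) + l * ?y"
      using c s cl by (simp add: l_def)
    also have "\<dots> powr p \<le> (1 - l) * (c + s) powr p + l * ?y powr p"
      using convex_onD[OF powr_convex[OF p], of l "c + s" ?y] l c s w by simp
    also have "\<dots> = K + M * w powr p"
      using w c s by (subst powr_mult) (auto simp: K_def M_def)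
    finally show ?thesis .
  qed
  then show "\<forall>w\<ge>0. (c + w) powr p \<le> K + M * w powr p"
    by blast
qed

lemma infsum_weighted_le_positive_part:
  fixes h t :: "'i \<Rightarrow> real"
  assumes h: "h summable_on UNIV" and ht: "(\<lambda>i. h i * t i) summable_on UNIV"
    and t: "\<And>i. 0 \<le> t i" "\<And>i. t i \<le> 1"
  shows "(\<Sum>\<^sub>\<infinity>i. h i * t i) \<le> infsum h {i. 0 < h i}"
proof (rule infsum_mono_neutral[OF ht])
  show "h summable_on {i. 0 < h i}"
    using h by (rule summable_on_subset_banach) simp
qed (use t in \<open>auto simp: mult_left_le not_less mult_nonpos_nonneg\<close>)

text \<open>
  The supporting line is taken at the point \<open>s\<^sup>p = \<Sum> g\<^sub>i t\<^sub>i\<close>. It may be vertical when \<open>s = 0\<close>;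
  then \<open>t\<close> vanishes wherever \<open>g\<close> does not, and the vertex supported where \<open>t\<close> is positive
  serves instead.
\<close>

lemma powr_infsum_le_on_cube:
  fixes f g t :: "'i \<Rightarrow> real"
  assumes p: "1 \<le> p" and c: "0 \<le> c"
    and f: "f summable_on UNIV" "\<And>i. 0 \<le> f i"
    and g: "g summable_on UNIV" "\<And>i. 0 \<le> g i"
    and t: "\<And>i. 0 \<le> t i" "\<And>i. t i \<le> 1"
    and vertex: "\<And>S. infsum f S powr (1 / p) \<le> infsum g S powr (1 / p) + c"
  shows "(\<Sum>\<^sub>\<infinity>i. f i * t i) powr (1 / p) \<le> (\<Sum>\<^sub>\<infinity>i. g i * t i) powr (1 / p) + c"
proof -
  have ft: "(\<lambda>i. f i * t i) summable_on UNIV"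
    by (rule summable_on_comparison_test[OF f(1)]) (use f t in \<open>auto simp: mult_left_le\<close>)
  have gt: "(\<lambda>i. g i * t i) summable_on UNIV"
    by (rule summable_on_comparison_test[OF g(1)]) (use g t in \<open>auto simp: mult_left_le\<close>)
  have sub: "f summable_on S" "g summable_on S" for S
    using f(1) g(1) summable_on_subset_banach by blast+
  have nonneg: "0 \<le> infsum f S" "0 \<le> infsum g S" for S
    using f g by (auto intro: infsum_nonneg)
  have ft_nonneg: "0 \<le> (\<Sum>\<^sub>\<infinity>i. f i * t i)"
    using f t by (auto intro!: infsum_nonneg)
  have gt_nonneg: "0 \<le> (\<Sum>\<^sub>\<infinity>i. g i * t i)"
    using g t by (auto intro!: infsum_nonneg)
  define s where "s = (\<Sum>\<^sub>\<infinity>i. g i * t i) powr (1 / p)"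
  have s_powr: "s powr p = (\<Sum>\<^sub>\<infinity>i. g i * t i)"
    using p gt_nonneg by (simp add: s_def powr_powr)
  show ?thesis
  proof (cases "s = 0")
    case True
    let ?S = "{i. 0 < t i}"
    have "(\<Sum>\<^sub>\<infinity>i. g i * t i) \<le> 0"
      using True s_powr by simp
    then have "g i * t i = 0" for i
      using gt by (rule nonneg_infsum_le_0D) (use g t in auto)
    then have "g i = 0" if "i \<in> ?S" for i
      using that by (metis mem_Collect_eq mult_eq_0_iff less_irrefl)
    then have "infsum g ?S = 0"
      by (rule infsum_0)
    have "(\<Sum>\<^sub>\<infinity>i. f i * t i) \<le> infsum f ?S"
      by (rule infsum_mono_neutral[OF ft sub(1)])
        (use f t in \<open>auto simp: mult_left_le not_less mult_nonneg_nonpos\<close>)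
    then have "(\<Sum>\<^sub>\<infinity>i. f i * t i) powr (1 / p) \<le> infsum f ?S powr (1 / p)"
      using p ft_nonneg by (intro powr_mono2) auto
    also have "\<dots> \<le> c"
      using vertex[of ?S] \<open>infsum g ?S = 0\<close> by simp
    finally show ?thesis
      using True by (simp add: s_def)
  next
    case False
    then have "0 < s"
      by (simp add: s_def)
    obtain K M where touch: "K + M * s powr p = (c + s) powr p"
      and above: "\<forall>w\<ge>0. (c + w) powr p \<le> K + M * w powr p"
      by (rule root_hypograph_supporting_line[OF p c \<open>0 < s\<close>])
    define h where "h = (\<lambda>i. f i + (- M) * g i)"
    let ?S = "{i. 0 < h i}"
    have Mg: "(\<lambda>i. (- M) * g i) summable_on S" for S
      using sub(2) by (rule summable_on_cmult_right)
    have Mgt: "(\<lambda>i. (- M) * (g i * t i)) summable_on UNIV"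
      using gt by (rule summable_on_cmult_right)
    have h: "h summable_on UNIV"
      unfolding h_def using f(1) Mg by (rule summable_on_add)
    have ht_eq: "(\<lambda>i. h i * t i) = (\<lambda>i. f i * t i + (- M) * (g i * t i))"
      by (auto simp: h_def algebra_simps)
    have ht: "(\<lambda>i. h i * t i) summable_on UNIV"
      unfolding ht_eq using ft Mgt by (rule summable_on_add)
    have "(\<Sum>\<^sub>\<infinity>i. f i * t i) - M * s powr p = (\<Sum>\<^sub>\<infinity>i. h i * t i)"
      unfolding ht_eq using infsum_add[OF ft Mgt] infsum_cmult_right'[of "- M" "\<lambda>i. g i * t i" UNIV]
      by (simp add: s_powr)
    also have "\<dots> \<le> infsum h ?S"
      using h ht t by (rule infsum_weighted_le_positive_part)
    also have "\<dots> = infsum f ?S - M * infsum g ?S"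
      unfolding h_def using infsum_add[OF sub(1) Mg] infsum_cmult_right'[of "- M" g]
      by simp
    also have "\<dots> \<le> K"
    proof -
      have "infsum f ?S = (infsum f ?S powr (1 / p)) powr p"
        using p nonneg by (simp add: powr_powr)
      also have "\<dots> \<le> (c + infsum g ?S powr (1 / p)) powr p"
        using vertex[of ?S] p by (intro powr_mono2) auto
      also have "\<dots> \<le> K + M * (infsum g ?S powr (1 / p)) powr p"
        using above by simp
      also have "(infsum g ?S powr (1 / p)) powr p = infsum g ?S"
        using p nonneg by (simp add: powr_powr)
      finally show ?thesis by simp
    qed
    finally have "(\<Sum>\<^sub>\<infinity>i. f i * t i) \<le> (c + s) powr p"
      using touch by simp
    then have "(\<Sum>\<^sub>\<infinity>i. f i * t i) powr (1 / p) \<le> ((c + s) powr p) powr (1 / p)"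
      using p ft_nonneg by (intro powr_mono2) auto
    also have "\<dots> = c + s"
      using p c \<open>0 < s\<close> by (simp add: powr_powr)
    finally show ?thesis
      by (simp add: s_def)
  qed
qed

section \<open>Distances in the products\<close>

lemma lp_prod_rescale_dist:
  assumes "\<And>n. 0 \<le> a n"
  shows "dst (lp_prod p (\<lambda>n. rescale (a n) (W n))) x y =
    (\<Sum>\<^sub>\<infinity>n. \<bar>a n\<bar> powr p * mdist (W n) (x n) (y n) powr p) powr (1 / p)"
  using assms by (simp add: lp_prod_def rescale_def powr_mult)

lemma lp_prod_rescale_dist_le:
  fixes W :: "nat \<Rightarrow> 'a metric"
  assumes p: "1 \<le> p" and diam: "\<And>n. metric_diam (W n) = 1"
    and a: "a \<in> lp_plus p" and b: "b \<in> lp_plus p" and c: "0 \<le> c"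
    and x: "\<And>n. x n \<in> mspace (W n)" and y: "\<And>n. y n \<in> mspace (W n)"
    and vertex: "\<And>S. (\<Sum>\<^sub>\<infinity>n\<in>S. \<bar>a n\<bar> powr p) powr (1 / p)
      \<le> (\<Sum>\<^sub>\<infinity>n\<in>S. \<bar>b n\<bar> powr p) powr (1 / p) + c"
  shows "dst (lp_prod p (\<lambda>n. rescale (a n) (W n))) x y
    \<le> dst (lp_prod p (\<lambda>n. rescale (b n) (W n))) x y + c"
proof -
  have t: "mdist (W n) (x n) (y n) powr p \<le> 1" for n
    using p mdist_le_1_if_diam_1[OF diam x y] by (simp add: powr_le1)
  have nonneg: "0 \<le> a n" "0 \<le> b n" for n
    using a b by (auto simp: lp_plus_def)
  have summable: "(\<lambda>n. \<bar>a n\<bar> powr p) summable_on UNIV" "(\<lambda>n. \<bar>b n\<bar> powr p) summable_on UNIV"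
    using a b by (auto simp: lp_plus_def)
  show ?thesis
    unfolding lp_prod_rescale_dist[OF nonneg(1)] lp_prod_rescale_dist[OF nonneg(2)]
    using powr_infsum_le_on_cube[OF p c summable(1) _ summable(2) _ _ t vertex] by simp
qed

lemma linf_prod_rescale_dist_le:
  fixes W :: "'i \<Rightarrow> 'b metric"
  assumes diam: "\<And>i. i \<in> A \<Longrightarrow> metric_diam (W i) = 1"
    and b: "\<And>i. i \<in> A \<Longrightarrow> 0 \<le> b i" "bdd_above (b ` A)" and c: "0 \<le> c"
    and x: "\<And>i. i \<in> A \<Longrightarrow> x i \<in> mspace (W i)" and y: "\<And>i. i \<in> A \<Longrightarrow> y i \<in> mspace (W i)"
    and coord: "\<And>i. i \<in> A \<Longrightarrow> a i \<le> b i + c"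
  shows "dst (linf_prod A (\<lambda>i. rescale (a i) (W i))) x y
    \<le> dst (linf_prod A (\<lambda>i. rescale (b i) (W i))) x y + c"
proof (cases "A = {}")
  case True
  then show ?thesis
    using c by (simp add: linf_prod_def sup0_def)
next
  case False
  let ?d = "\<lambda>i. mdist (W i) (x i) (y i)"
  have d: "?d i \<le> 1" if "i \<in> A" for i
    using that diam x y by (intro mdist_le_1_if_diam_1) auto
  obtain B where B: "b i \<le> B" if "i \<in> A" for i
    using b(2) by (auto simp: bdd_above_def)
  have "b i * ?d i \<le> B" if "i \<in> A" for i
    using that b(1) d B by (meson mult_left_le order_trans)
  then have bdd: "bdd_above ((\<lambda>i. b i * ?d i) ` A)"
    by (rule bdd_aboveI2)
  have "a i * ?d i \<le> (SUP i\<in>A. b i * ?d i) + c" if i: "i \<in> A" for i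
  proof -
    have "a i * ?d i \<le> b i * ?d i + c * ?d i"
      using mult_right_mono[OF coord[OF i], of "?d i"] by (simp add: algebra_simps)
    also have "b i * ?d i \<le> (SUP i\<in>A. b i * ?d i)"
      using i bdd by (rule cSUP_upper)
    also have "c * ?d i \<le> c"
      using c d[OF i] by (simp add: mult_left_le)
    finally show ?thesis by simp
  qed
  then show ?thesis
    using False by (auto simp: linf_prod_def rescale_def sup0_def intro!: cSUP_least)
qed

section \<open>The distance estimates\<close>

theorem theorem3p10:
  "(\<forall>(p::real) (W :: nat \<Rightarrow> 'a metric) a b.
      1 \<le> p \<longrightarrow> (\<forall>n. metric_diam (W n) = 1) \<longrightarrow> a \<in> lp_plus p \<longrightarrow> b \<in> lp_plus p \<longrightarrow>
      2 * gh_dist (lp_prod p (\<lambda>n. rescale (a n) (W n))) (lp_prod p (\<lambda>n. rescale (b n) (W n)))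
        \<le> (SUP S\<in>(UNIV :: nat set set).
             ennreal \<bar>(\<Sum>\<^sub>\<infinity>n\<in>S. \<bar>a n\<bar> powr p) powr (1 / p) - (\<Sum>\<^sub>\<infinity>n\<in>S. \<bar>b n\<bar> powr p) powr (1 / p)\<bar>))
   \<and>
   (\<forall>(A :: 'i set) (W :: 'i \<Rightarrow> 'b metric) (a :: 'i \<Rightarrow> real) (b :: 'i \<Rightarrow> real).
      (\<forall>\<alpha>\<in>A. metric_diam (W \<alpha>) = 1) \<longrightarrow>
      (\<forall>\<alpha>\<in>A. 0 \<le> a \<alpha>) \<longrightarrow> (\<forall>\<alpha>\<in>A. 0 \<le> b \<alpha>) \<longrightarrow>
      bdd_above (a ` A) \<longrightarrow> bdd_above (b ` A) \<longrightarrow>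
      2 * gh_dist (linf_prod A (\<lambda>\<beta>. rescale (a \<beta>) (W \<beta>))) (linf_prod A (\<lambda>\<beta>. rescale (b \<beta>) (W \<beta>)))
        \<le> (SUP S\<in>Pow A. ennreal \<bar>sup0 S a - sup0 S b\<bar>))"
proof (intro conjI allI impI)
  fix p :: real and W :: "nat \<Rightarrow> 'a metric" and a b
  assume p: "1 \<le> p" and diam: "\<forall>n. metric_diam (W n) = 1"
    and a: "a \<in> lp_plus p" and b: "b \<in> lp_plus p"
  let ?X = "lp_prod p (\<lambda>n. rescale (a n) (W n))"
  let ?Y = "lp_prod p (\<lambda>n. rescale (b n) (W n))"
  show "2 * gh_dist ?X ?Y \<le> (SUP S\<in>(UNIV :: nat set set).
    ennreal \<bar>(\<Sum>\<^sub>\<infinity>n\<in>S. \<bar>a n\<bar> powr p) powr (1 / p) - (\<Sum>\<^sub>\<infinity>n\<in>S. \<bar>b n\<bar> powr p) powr (1 / p)\<bar>)"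
  proof (rule le_SUP_ennrealI)
    fix c :: real
    assume c: "0 \<le> c" and vertex: "\<And>S. S \<in> UNIV \<Longrightarrow>
      \<bar>(\<Sum>\<^sub>\<infinity>n\<in>S. \<bar>a n\<bar> powr p) powr (1 / p) - (\<Sum>\<^sub>\<infinity>n\<in>S. \<bar>b n\<bar> powr p) powr (1 / p)\<bar> \<le> c"
    show "2 * gh_dist ?X ?Y \<le> ennreal c"
    proof (rule gh_dist_same_carrier_le)
      show "carr ?X = carr ?Y"
        by (simp add: lp_prod_def rescale_def)
    next
      fix x y assume "x \<in> carr ?X" "y \<in> carr ?X"
      then have xy: "x n \<in> mspace (W n)" "y n \<in> mspace (W n)" for n
        by (auto simp: lp_prod_def rescale_def PiE_iff)
      have vertex_ab: "(\<Sum>\<^sub>\<infinity>n\<in>S. \<bar>a n\<bar> powr p) powr (1 / p)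
          \<le> (\<Sum>\<^sub>\<infinity>n\<in>S. \<bar>b n\<bar> powr p) powr (1 / p) + c"
        and vertex_ba: "(\<Sum>\<^sub>\<infinity>n\<in>S. \<bar>b n\<bar> powr p) powr (1 / p)
          \<le> (\<Sum>\<^sub>\<infinity>n\<in>S. \<bar>a n\<bar> powr p) powr (1 / p) + c" for S
        using vertex[of S] by (simp_all add: abs_le_iff)
      have "dst ?X x y \<le> dst ?Y x y + c"
        using diam by (intro lp_prod_rescale_dist_le[OF p _ a b c xy vertex_ab]) simp
      moreover have "dst ?Y x y \<le> dst ?X x y + c"
        using diam by (intro lp_prod_rescale_dist_le[OF p _ b a c xy vertex_ba]) simp
      ultimately show "\<bar>dst ?X x y - dst ?Y x y\<bar> \<le> c"
        by linarith
    qed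
  qed simp
next
  fix A :: "'i set" and W :: "'i \<Rightarrow> 'b metric" and a b :: "'i \<Rightarrow> real"
  assume diam: "\<forall>\<alpha>\<in>A. metric_diam (W \<alpha>) = 1"
    and a: "\<forall>\<alpha>\<in>A. 0 \<le> a \<alpha>" "bdd_above (a ` A)"
    and b: "\<forall>\<alpha>\<in>A. 0 \<le> b \<alpha>" "bdd_above (b ` A)"
  let ?X = "linf_prod A (\<lambda>\<beta>. rescale (a \<beta>) (W \<beta>))"
  let ?Y = "linf_prod A (\<lambda>\<beta>. rescale (b \<beta>) (W \<beta>))"
  show "2 * gh_dist ?X ?Y \<le> (SUP S\<in>Pow A. ennreal \<bar>sup0 S a - sup0 S b\<bar>)"
  proof (rule le_SUP_ennrealI)
    fix c :: real
    assume c: "0 \<le> c" and sets: "\<And>S. S \<in> Pow A \<Longrightarrow> \<bar>sup0 S a - sup0 S b\<bar> \<le> c"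
    have "\<bar>a i - b i\<bar> \<le> c" if "i \<in> A" for i
      using sets[of "{i}"] that by (simp add: sup0_def)
    then have coord: "a i \<le> b i + c" "b i \<le> a i + c" if "i \<in> A" for i
      using that by (force simp: abs_le_iff)+
    show "2 * gh_dist ?X ?Y \<le> ennreal c"
    proof (rule gh_dist_same_carrier_le)
      show "carr ?X = carr ?Y"
        by (simp add: linf_prod_def rescale_def)
    next
      fix x y assume "x \<in> carr ?X" "y \<in> carr ?X"
      then have xy: "x i \<in> mspace (W i)" "y i \<in> mspace (W i)" if "i \<in> A" for i
        using that by (auto simp: linf_prod_def rescale_def PiE_iff)
      have "dst ?X x y \<le> dst ?Y x y + c"
        using diam b c xy coord by (intro linf_prod_rescale_dist_le) auto
      moreover have "dst ?Y x y \<le> dst ?X x y + c"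
        using diam a c xy coord by (intro linf_prod_rescale_dist_le) auto
      ultimately show "\<bar>dst ?X x y - dst ?Y x y\<bar> \<le> c"
        by linarith
    qed
  qed auto
qed

end
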